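(* Let $d\in\mathbb{N}$, let $\Omega\subset\mathbb{R}^d$ be open with $[0,1]^d\subset\Omega$, and let $f$ be analytic on $\Omega$. If $f$ satisfies, for some $C>0$, that $|f|_{W^{s,\infty}([0,1]^d)}\le C^s$ for all $s\in\mathbb{N}$, then for every $\mathcal{N}\in\mathbb{N}$ there exists a shallow tanh neural network $\widehat f^{\mathcal{N}}$ of width $$3\left\lceil\frac{\mathcal{N}+5Cd}{2}\right\rceil\binom{\mathcal{N}+(5C+1)d}{\mathcal{N}+5Cd}$$ (or $3\left\lceil\frac{\mathcal{N}}{2}\right\rceil$ for $d=1$) such that $$\|f-\widehat f^{\mathcal{N}}\|_{L^\infty([0,1]^d)}\le\exp(-\mathcal{N}).$$
   Context: $\mathbb{N}=\{1,2,\dots\}$. $|f|_{W^{m,\infty}(\Omega)}=\max_{|\alpha|=m}\|D^\alpha f\|_{L^\infty(\Omega)}$. For real $x\ge0$ and $d\in\mathbb{N}$, $\binom{x+d}{x}$ denotes $\prod_{i=1}^d\frac{x+i}{i}$, the usual binomial coefficient when $x$ is an integer. A shallow tanh neural network is a function $\mathbb{R}^{l_0}\to\mathbb{R}^{l_2}$ of the form $x\mapsto W_2\,\sigma(W_1x+b_1)+b_2$ with $W_1\in\mathbb{R}^{l_1\times l_0}$, $b_1\in\mathbb{R}^{l_1}$, $W_2\in\mathbb{R}^{l_2\times l_1}$, $b_2\in\mathbb{R}^{l_2}$, and $\sigma=\tanh$ applied componentwise, i.e. a network with exactly one hidden layer; its width is $\max(l_0,l_1,l_2)$.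
   Formalization: For d=1 the width is taken as 3⌈(N+5C)/2⌉ instead of the printed 3⌈N/2⌉, which fails for f(x)=sin(Cx) with N=1 and C large; a non-integer width expression is read as its integer part. *)

theory Defs
  imports "HOL-Analysis.Analysis" "HOL-Probability.Essential_Supremum"
begin

abbreviation unit_cube :: "(real ^ 'n) set"
  where "unit_cube \<equiv> cbox 0 1"

definition partial :: "'n \<Rightarrow> (real ^ 'n \<Rightarrow> real) \<Rightarrow> real ^ 'n \<Rightarrow> real"
  where "partial i f x = deriv (\<lambda>t. f (x + t *\<^sub>R axis i 1)) 0"

text \<open>
  A multi-index is a function \<open>\<alpha> :: 'n \<Rightarrow> nat\<close> of order \<open>\<Sum>i. \<alpha> i\<close>. The index type carries
  no order, so the coordinates are differentiated in an unspecified but fixed order, which is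
  immaterial for smooth functions.
\<close>

definition multi_partial :: "('n::finite \<Rightarrow> nat) \<Rightarrow> (real ^ 'n \<Rightarrow> real) \<Rightarrow> real ^ 'n \<Rightarrow> real"
  where "multi_partial \<alpha> f =
    fold (\<lambda>i. partial i ^^ \<alpha> i) (SOME is. distinct is \<and> set is = UNIV) f"

definition Linf_norm :: "(real ^ 'n) set \<Rightarrow> (real ^ 'n \<Rightarrow> real) \<Rightarrow> ereal"
  where "Linf_norm S g = esssup (lebesgue_on S) (\<lambda>x. ereal \<bar>g x\<bar>)"

text \<open>
  The partial derivatives are classical, taken in the ambient space; the seminorm is
  meant for functions that are smooth on a neighbourhood of \<open>S\<close>.
\<close>

definition Sobolev_seminorm :: "nat \<Rightarrow> (real ^ 'n::finite) set \<Rightarrow> (real ^ 'n \<Rightarrow> real) \<Rightarrow> ereal"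
  where "Sobolev_seminorm m S f =
    Max ((\<lambda>\<alpha>. Linf_norm S (multi_partial \<alpha> f)) ` {\<alpha>. (\<Sum>i\<in>UNIV. \<alpha> i) = m})"

text \<open>
  Real analyticity (the library's \<open>analytic_on\<close> is complex analyticity in one variable): near each
  point the function is the sum of its multivariate power series.
\<close>

definition real_analytic_on :: "(real ^ 'n::finite \<Rightarrow> real) \<Rightarrow> (real ^ 'n) set \<Rightarrow> bool"
  where "real_analytic_on f S \<longleftrightarrow>
    (\<forall>a\<in>S. \<exists>r>0. \<exists>c :: ('n \<Rightarrow> nat) \<Rightarrow> real. \<forall>x\<in>ball a r.
       ((\<lambda>\<alpha>. c \<alpha> * (\<Prod>i\<in>UNIV. (x $ i - a $ i) ^ \<alpha> i)) has_sum f x) UNIV)"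

text \<open>
  The map \<open>x \<mapsto> W2 tanh(W1 x + b1) + b2\<close> with \<open>l\<close> hidden neurons. Since \<open>l\<close> is a
  number and not a type, the hidden layer is indexed by \<open>j < l\<close>: \<open>W1 j\<close> is the \<open>j\<close>-th row of the
  first weight matrix, and \<open>W2 $ k\<close> is the \<open>k\<close>-th row of the second one.
\<close>

definition shallow_tanh_net ::
  "nat \<Rightarrow> (nat \<Rightarrow> real ^ 'n) \<Rightarrow> (nat \<Rightarrow> real) \<Rightarrow> (nat \<Rightarrow> real) ^ 'm \<Rightarrow> real ^ 'm \<Rightarrow>
   real ^ 'n \<Rightarrow> real ^ 'm"
  where "shallow_tanh_net l W1 b1 W2 b2 x =
    (\<chi> k. (\<Sum>j<l. (W2 $ k) j * tanh ((\<Sum>i\<in>UNIV. W1 j $ i * x $ i) + b1 j)) + b2 $ k)"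

definition is_shallow_tanh_net :: "nat \<Rightarrow> (real ^ 'n::finite \<Rightarrow> real ^ 'm::finite) \<Rightarrow> bool"
  where "is_shallow_tanh_net w g \<longleftrightarrow>
    (\<exists>l W1 b1 W2 b2. 1 \<le> l \<and> w = Max {CARD('n), l, CARD('m)} \<and>
       g = shallow_tanh_net l W1 b1 W2 b2)"

text \<open>The binomial coefficient of \<open>x + d\<close> over \<open>x\<close> for real \<open>x\<close>.\<close>

definition real_binomial :: "real \<Rightarrow> nat \<Rightarrow> real"
  where "real_binomial x d = (\<Prod>i=1..d. (x + real i) / real i)"

end

theory Submission
  imports Defs
begin

text \<open>
  Put \<open>D = \<lfloor>N + 5Cd\<rfloor>\<close> and let \<open>p\<close> be the Taylor polynomial of \<open>f\<close> of degree \<open>D\<close> at the centre of the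
  cube. With \<open>s = D + 1\<close> its error is at most \<open>(Cd/2)^s / s!\<close>, and since \<open>5Cd \<le> s\<close> and \<open>s^s / s! \<le> e^s\<close>
  this is at most \<open>(e/10)^s\<close>, strictly below \<open>e^{-N}\<close>.

  Fix \<open>b\<close> such that no derivative of tanh of order at most \<open>D\<close> vanishes at \<open>b\<close>. By the mean value
  theorem the iterated difference of \<open>tanh\<close> at \<open>b\<close> with steps \<open>h v\<^sub>i\<close>, \<open>i\<close> running through a list of length
  \<open>m\<close>, is \<open>h^m\<close> times the monomial \<open>\<Prod> v\<^sub>i\<close> times a value of the \<open>m\<close>-th derivative near \<open>b\<close>. So every polynomial of
  degree at most \<open>D\<close> is a limit for \<open>h \<rightarrow> 0\<close> of combinations of the neurons \<open>tanh (b + h k \<cdot> v)\<close> with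
  \<open>k \<in> \<nat>\<^sup>d\<close> and \<open>|k| \<le> D\<close>. There are only \<open>D + d\<close> over \<open>d\<close> of these; neurons with zero output weight fill
  up the prescribed width.
\<close>

section \<open>Multivariate power series\<close>

definition vmonom :: "('n::finite \<Rightarrow> nat) \<Rightarrow> real ^ 'n \<Rightarrow> real"
  where "vmonom \<alpha> y = (\<Prod>j\<in>UNIV. (y $ j) ^ \<alpha> j)"

text \<open>The derivative of \<open>vmonom \<alpha>\<close> in direction \<open>i\<close>; if
  \<open>\<alpha> i = 0\<close>, the factor \<open>real (\<alpha> i)\<close> makes the truncated
  exponent harmless.\<close>

definition vmonom_partial :: "'n::finite \<Rightarrow> ('n \<Rightarrow> nat) \<Rightarrow> real ^ 'n \<Rightarrow> real"
  where "vmonom_partial i \<alpha> y = real (\<alpha> i) * (y $ i) ^ (\<alpha> i - 1) * (\<Prod>j\<in>UNIV - {i}. (y $ j) ^ \<alpha> j)"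

text \<open>Coefficients of the termwise derivative: the one at \<beta> stems from the multi-index
  whose \<open>i\<close>-th entry is larger by one.\<close>

definition coef_partial :: "'n \<Rightarrow> (('n \<Rightarrow> nat) \<Rightarrow> real) \<Rightarrow> ('n \<Rightarrow> nat) \<Rightarrow> real"
  where "coef_partial i c \<beta> = real (Suc (\<beta> i)) * c (\<beta>(i := Suc (\<beta> i)))"

text \<open>The local condition of \<open>real_analytic_on\<close> with coefficients and radius
  exposed, so that both can be tracked through differentiation.\<close>

definition power_series_on :: "(('n::finite \<Rightarrow> nat) \<Rightarrow> real) \<Rightarrow> real ^ 'n \<Rightarrow> real \<Rightarrow> (real ^ 'n \<Rightarrow> real) \<Rightarrow> bool"
  where "power_series_on c a r f \<longleftrightarrow> (\<forall>x\<in>ball a r. ((\<lambda>\<alpha>. c \<alpha> * vmonom \<alpha> (x - a)) has_sum f x) UNIV)"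

lemma vmonom_split: "vmonom \<alpha> y = (y $ i) ^ \<alpha> i * (\<Prod>j\<in>UNIV - {i}. (y $ j) ^ \<alpha> j)"
  unfolding vmonom_def by (subst prod.remove[of _ i]) auto

lemma has_derivative_vmonom:
  "((\<lambda>x. vmonom \<alpha> (x - a)) has_derivative (\<lambda>h. \<Sum>i\<in>UNIV. h $ i * vmonom_partial i \<alpha> (x - a))) (at x within S)"
proof -
  have c: "((\<lambda>x. (x - a) $ i) has_derivative (\<lambda>h. h $ i)) (at x within S)" for i
    by (auto intro!: derivative_eq_intros bounded_linear.has_derivative[OF bounded_linear_vec_nth])
  show ?thesis
    unfolding vmonom_def vmonom_partial_def
    by (rule has_derivative_eq_rhs, rule has_derivative_prod, rule has_derivative_power, rule c)
       (auto intro!: ext sum.cong)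
qed

lemma vmonom_partial_Suc:
  "vmonom_partial i (\<beta>(i := Suc (\<beta> i))) y = real (Suc (\<beta> i)) * vmonom \<beta> y"
proof -
  have "(\<Prod>j\<in>UNIV - {i}. (y $ j) ^ (\<beta>(i := Suc (\<beta> i))) j) = (\<Prod>j\<in>UNIV - {i}. (y $ j) ^ \<beta> j)"
    by (intro prod.cong) auto
  then show ?thesis
    unfolding vmonom_partial_def by (simp add: vmonom_split[of \<beta> y i] algebra_simps)
qed

text \<open>For \<open>n > 0\<close> the left side is a single term of the binomial expansion of the
  right side.\<close>

lemma mult_power_le_power_add:
  fixes t \<delta> :: real
  assumes "0 \<le> t" "0 < \<delta>"
  shows "real n * t ^ (n - 1) * \<delta> \<le> (t + \<delta>) ^ n"
proof (induction n)
  case (Suc n)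
  have "real (Suc n) * t ^ n * \<delta> = t * (real n * t ^ (n - 1) * \<delta>) + t ^ n * \<delta>"
    by (cases n) (auto simp: algebra_simps)
  also have "\<dots> \<le> t * (t + \<delta>) ^ n + (t + \<delta>) ^ n * \<delta>"
    using Suc assms by (intro add_mono mult_left_mono mult_right_mono power_mono) auto
  finally show ?case by (simp add: algebra_simps)
qed simp

text \<open>A Cauchy-type estimate: moving every coordinate outwards by \<delta> absorbs the factor
  \<open>real (\<alpha> i)\<close>, so the loss \<open>1 / \<delta>\<close> is the same for all
  \<alpha>.\<close>

lemma vmonom_partial_bound:
  assumes "0 < \<delta>" and "\<And>j. \<bar>y $ j\<bar> + \<delta> \<le> z $ j"
  shows "\<bar>vmonom_partial i \<alpha> y\<bar> \<le> vmonom \<alpha> z / \<delta>"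
proof -
  have z: "0 \<le> z $ j" "\<bar>y $ j\<bar> \<le> z $ j" for j
    using assms(2)[of j] assms(1) abs_ge_zero[of "y $ j"] by linarith+
  have "real (\<alpha> i) * \<bar>y $ i\<bar> ^ (\<alpha> i - 1) * \<delta> \<le> (\<bar>y $ i\<bar> + \<delta>) ^ \<alpha> i"
    using assms by (intro mult_power_le_power_add) auto
  also have "\<dots> \<le> (z $ i) ^ \<alpha> i" using assms by (intro power_mono) auto
  finally have 1: "real (\<alpha> i) * \<bar>y $ i\<bar> ^ (\<alpha> i - 1) \<le> (z $ i) ^ \<alpha> i / \<delta>"
    using assms(1) by (simp add: field_simps)
  have "\<bar>vmonom_partial i \<alpha> y\<bar> = (real (\<alpha> i) * \<bar>y $ i\<bar> ^ (\<alpha> i - 1)) * (\<Prod>j\<in>UNIV - {i}. \<bar>y $ j\<bar> ^ \<alpha> j)"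
    by (simp add: vmonom_partial_def abs_mult power_abs abs_prod)
  also have "\<dots> \<le> ((z $ i) ^ \<alpha> i / \<delta>) * (\<Prod>j\<in>UNIV - {i}. (z $ j) ^ \<alpha> j)"
    using assms(1) z by (intro mult_mono 1 prod_mono) (auto intro!: power_mono prod_nonneg)
  also have "\<dots> = vmonom \<alpha> z / \<delta>" by (simp add: vmonom_split[of \<alpha> z i])
  finally show ?thesis .
qed

text \<open>
  The point \<open>a + z\<close> still lies in the ball of convergence, so the series at \<open>z\<close> dominates the
  differentiated series on all of \<open>ball x \<delta>\<close>.
\<close>

lemma power_series_on_majorant:
  fixes a x :: "real ^ 'n::finite"
  assumes "power_series_on c a r f" "x \<in> ball a r"
  obtains \<delta> z where "\<delta> > 0" "\<And>y j. y \<in> ball x \<delta> \<Longrightarrow> \<bar>(y - a) $ j\<bar> + \<delta> \<le> z $ j"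
    "ball x \<delta> \<subseteq> ball a r" "(\<lambda>\<alpha>. \<bar>c \<alpha>\<bar> * vmonom \<alpha> z) summable_on UNIV"
proof -
  define m where "m = norm (1 :: real ^ 'n)"
  have m: "m > 0" by (simp add: m_def)
  \<comment> \<open>As \<open>m\<close> is the norm of the all-ones vector, a shift by
    \<open>2 * \<delta>\<close> in every coordinate uses half of the gap
    \<open>r - dist a x\<close>. In \<open>z\<close>, one \<delta> of the shift covers
    \<open>y - x\<close> and the other is the margin.\<close>
  define \<delta> where "\<delta> = (r - dist a x) / (4 * m)"
  have d: "\<delta> > 0" using m assms(2) by (auto simp: \<delta>_def)
  define z :: "real ^ 'n" where "z = (\<chi> j. \<bar>x $ j - a $ j\<bar> + 2 * \<delta>)"
  have zeq: "z = (\<chi> j. \<bar>x $ j - a $ j\<bar>) + (2 * \<delta>) *\<^sub>R 1"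
    by (simp add: z_def vec_eq_iff)
  have "norm (\<chi> j. \<bar>x $ j - a $ j\<bar>) = dist a x"
    unfolding norm_vec_def dist_vec_def by (simp add: dist_real_def abs_minus_commute)
  then have "norm z \<le> dist a x + 2 * \<delta> * m"
    using d unfolding zeq by (intro order_trans[OF norm_triangle_ineq]) (simp add: m_def)
  also have "2 * \<delta> * m = (r - dist a x) / 2" using m by (simp add: \<delta>_def)
  also have "dist a x + (r - dist a x) / 2 < r" using assms(2) by (simp add: field_simps)
  finally have nz: "norm z < r" .
  have z: "\<bar>(y - a) $ j\<bar> + \<delta> \<le> z $ j" if "y \<in> ball x \<delta>" for y j
  proof -
    have "\<bar>(y - x) $ j\<bar> \<le> norm (y - x)" by (rule component_le_norm_cart)
    then show ?thesis using that by (auto simp: z_def dist_norm norm_minus_commute)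
  qed
  have sub: "ball x \<delta> \<subseteq> ball a r"
  proof
    fix y assume y: "y \<in> ball x \<delta>"
    have "norm (y - a) \<le> norm z"
    proof (rule norm_le_componentwise_cart)
      fix j show "norm ((y - a) $ j) \<le> norm (z $ j)" using z[OF y, of j] d by simp
    qed
    then show "y \<in> ball a r" using nz by (simp add: dist_norm norm_minus_commute)
  qed
  have z0: "0 \<le> z $ j" for j using d by (simp add: z_def)
  have "a + z \<in> ball a r" using nz by (simp add: dist_norm)
  then have "((\<lambda>\<alpha>. c \<alpha> * vmonom \<alpha> (a + z - a)) has_sum f (a + z)) UNIV"
    using assms(1) unfolding power_series_on_def by blast
  then have "(\<lambda>\<alpha>. c \<alpha> * vmonom \<alpha> z) summable_on UNIV"
    by (auto dest: has_sum_imp_summable)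
  \<comment> \<open>Unordered summability of reals is absolute.\<close>
  then have "(\<lambda>\<alpha>. \<bar>c \<alpha> * vmonom \<alpha> z\<bar>) summable_on UNIV"
    using summable_on_iff_abs_summable_on_real[of "\<lambda>\<alpha>. c \<alpha> * vmonom \<alpha> z" UNIV]
    by (simp only: real_norm_def)
  moreover have "\<bar>c \<alpha> * vmonom \<alpha> z\<bar> = \<bar>c \<alpha>\<bar> * vmonom \<alpha> z" for \<alpha>
    using z0 by (simp add: abs_mult vmonom_def prod_nonneg)
  ultimately have "(\<lambda>\<alpha>. \<bar>c \<alpha>\<bar> * vmonom \<alpha> z) summable_on UNIV" by simp
  then show ?thesis by (intro that[of \<delta> z] d z sub)
qed

text \<open>Termwise differentiation. Near \<open>x\<close> the differentiated series are dominated
  by the majorant divided by \<delta>, so by the Weierstrass test they converge uniformly, and limit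
  and derivative may be exchanged.\<close>

lemma power_series_on_has_derivative:
  fixes a x :: "real ^ 'n::finite"
  assumes ps: "power_series_on c a r f" and x: "x \<in> ball a r"
  shows "(f has_derivative (\<lambda>h. \<Sum>i\<in>UNIV. h $ i * (\<Sum>\<^sub>\<infinity>\<alpha>. c \<alpha> * vmonom_partial i \<alpha> (x - a)))) (at x)"
    and "(\<lambda>\<alpha>. c \<alpha> * vmonom_partial i \<alpha> (x - a)) summable_on UNIV"
proof -
  obtain \<delta> z where d: "\<delta> > 0" and z: "\<And>y j. y \<in> ball x \<delta> \<Longrightarrow> \<bar>(y - a) $ j\<bar> + \<delta> \<le> z $ j"
    and sub: "ball x \<delta> \<subseteq> ball a r" and sm: "(\<lambda>\<alpha>. \<bar>c \<alpha>\<bar> * vmonom \<alpha> z) summable_on UNIV"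
    using power_series_on_majorant[OF ps x] by blast
  have bd: "\<bar>c \<alpha> * vmonom_partial i \<alpha> (y - a)\<bar> \<le> \<bar>c \<alpha>\<bar> * vmonom \<alpha> z * (1 / \<delta>)" if "y \<in> ball x \<delta>" for y \<alpha> i
    using mult_left_mono[OF vmonom_partial_bound[OF d z[OF that], of i \<alpha>], of "\<bar>c \<alpha>\<bar>"]
    by (simp add: abs_mult)
  have sm': "(\<lambda>\<alpha>. \<bar>c \<alpha>\<bar> * vmonom \<alpha> z * (1 / \<delta>)) summable_on UNIV"
    by (rule summable_on_cmult_left[OF sm])
  have psm: "(\<lambda>\<alpha>. c \<alpha> * vmonom_partial i \<alpha> (y - a)) summable_on UNIV" if "y \<in> ball x \<delta>" for y i
  proof -
    have "(\<lambda>\<alpha>. norm (c \<alpha> * vmonom_partial i \<alpha> (y - a))) summable_on UNIV"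
      by (rule summable_on_comparison_test[OF sm']) (use bd[OF that] in auto)
    then show ?thesis by (rule abs_summable_summable)
  qed
  show "(\<lambda>\<alpha>. c \<alpha> * vmonom_partial i \<alpha> (x - a)) summable_on UNIV" using psm d by simp
  \<comment> \<open>The theorem on differentiating series works with series over \<open>nat\<close>,
    hence an enumeration of the multi-indices, of which there are infinitely many because
    \<open>'n\<close> is nonempty.\<close>
  define e :: "nat \<Rightarrow> 'n \<Rightarrow> nat" where "e = from_nat_into UNIV"
  have "infinite (UNIV :: ('n \<Rightarrow> nat) set)"
    by (simp add: finite_UNIV_fun)
  then have e: "bij_betw e UNIV UNIV"
    unfolding e_def by (intro bij_betw_from_nat_into) auto
  have sums: "(\<lambda>n. q (e n)) sums (\<Sum>\<^sub>\<infinity>\<alpha>. q \<alpha>)" if "q summable_on UNIV" for q :: "('n \<Rightarrow> nat) \<Rightarrow> real"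
    using has_sum_reindex_bij_betw[OF e, of q] that has_sum_infsum[OF that] by (intro has_sum_imp_sums) auto
  define G where "G i y = (\<Sum>\<^sub>\<infinity>\<alpha>. c \<alpha> * vmonom_partial i \<alpha> (y - a))" for i y
  have unif: "uniform_limit (ball x \<delta>) (\<lambda>n y. \<Sum>k<n. c (e k) * vmonom_partial i (e k) (y - a)) (G i) sequentially" for i
  proof -
    have "uniform_limit (ball x \<delta>) (\<lambda>n y. \<Sum>k<n. c (e k) * vmonom_partial i (e k) (y - a))
        (\<lambda>y. suminf (\<lambda>k. c (e k) * vmonom_partial i (e k) (y - a))) sequentially"
      by (rule Weierstrass_m_test[where M = "\<lambda>k. \<bar>c (e k)\<bar> * vmonom (e k) z * (1 / \<delta>)"])
         (use bd sums[OF sm'] in \<open>auto simp: sums_iff\<close>)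
    then show ?thesis
      by (rule uniform_limit_cong'[THEN iffD1, rotated -1])
         (use sums[OF psm] in \<open>auto simp: sums_iff G_def\<close>)
  qed
  have "\<exists>g. \<forall>y\<in>ball x \<delta>. (\<lambda>n. c (e n) * vmonom (e n) (y - a)) sums (g y) \<and>
     (g has_derivative (\<lambda>h. \<Sum>i\<in>UNIV. h $ i * G i y)) (at y within ball x \<delta>)"
  proof (rule has_derivative_series)
    fix n y
    show "((\<lambda>y. c (e n) * vmonom (e n) (y - a)) has_derivative
        (\<lambda>h. c (e n) * (\<Sum>i\<in>UNIV. h $ i * vmonom_partial i (e n) (y - a)))) (at y within ball x \<delta>)"
      by (intro has_derivative_mult_right has_derivative_vmonom)
  next
    fix \<epsilon> :: real assume "\<epsilon> > 0"
    \<comment> \<open>Each of the \<open>CARD('n)\<close> coordinates contributes at most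
      \<open>norm h * \<eta>\<close> to the error of the derivative.\<close>
    define \<eta> where "\<eta> = \<epsilon> / CARD('n)"
    have "\<eta> > 0" using \<open>\<epsilon> > 0\<close> by (simp add: \<eta>_def)
    then have "\<forall>\<^sub>F n in sequentially. \<forall>i. \<forall>y\<in>ball x \<delta>. dist (\<Sum>k<n. c (e k) * vmonom_partial i (e k) (y - a)) (G i y) < \<eta>"
      using unif by (intro eventually_all_finite) (auto simp: uniform_limit_iff)
    then show "\<forall>\<^sub>F n in sequentially. \<forall>y\<in>ball x \<delta>. \<forall>h. norm ((\<Sum>k<n. c (e k) * (\<Sum>i\<in>UNIV. h $ i * vmonom_partial i (e k) (y - a)))
         - (\<Sum>i\<in>UNIV. h $ i * G i y)) \<le> \<epsilon> * norm h"
    proof eventually_elim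
      case (elim n)
      show ?case
      proof (intro ballI allI)
        fix y and h :: "real ^ 'n" assume y: "y \<in> ball x \<delta>"
        have "(\<Sum>k<n. c (e k) * (\<Sum>i\<in>UNIV. h $ i * vmonom_partial i (e k) (y - a))) - (\<Sum>i\<in>UNIV. h $ i * G i y)
          = (\<Sum>i\<in>UNIV. h $ i * ((\<Sum>k<n. c (e k) * vmonom_partial i (e k) (y - a)) - G i y))"
          unfolding sum_distrib_left right_diff_distrib sum_subtractf
          by (subst sum.swap) (simp add: mult.left_commute)
        also have "norm \<dots> \<le> (\<Sum>i\<in>(UNIV::'n set). norm h * \<eta>)"
        proof (intro order_trans[OF norm_sum] sum_mono)
          fix i
          have "\<bar>(\<Sum>k<n. c (e k) * vmonom_partial i (e k) (y - a)) - G i y\<bar> \<le> \<eta>"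
            using elim y by (auto simp: dist_real_def intro: less_imp_le)
          then show "norm (h $ i * ((\<Sum>k<n. c (e k) * vmonom_partial i (e k) (y - a)) - G i y)) \<le> norm h * \<eta>"
            by (simp add: abs_mult mult_mono component_le_norm_cart)
        qed
        also have "\<dots> = \<epsilon> * norm h" by (simp add: \<eta>_def)
        finally show "norm ((\<Sum>k<n. c (e k) * (\<Sum>i\<in>UNIV. h $ i * vmonom_partial i (e k) (y - a)))
         - (\<Sum>i\<in>UNIV. h $ i * G i y)) \<le> \<epsilon> * norm h" .
      qed
    qed
  next
    show "x \<in> ball x \<delta>" using d by simp
    show "(\<lambda>n. c (e n) * vmonom (e n) (x - a)) sums (\<Sum>\<^sub>\<infinity>\<alpha>. c \<alpha> * vmonom \<alpha> (x - a))"
      using ps x by (intro sums) (auto simp: power_series_on_def summable_on_def)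
  qed simp
  then obtain g where g: "\<And>y. y \<in> ball x \<delta> \<Longrightarrow> (\<lambda>n. c (e n) * vmonom (e n) (y - a)) sums (g y)"
     "\<And>y. y \<in> ball x \<delta> \<Longrightarrow> (g has_derivative (\<lambda>h. \<Sum>i\<in>UNIV. h $ i * G i y)) (at y within ball x \<delta>)"
    by blast
  \<comment> \<open>The enumerated and the unordered sum agree, so the limit function is
    \<open>f\<close> itself.\<close>
  have gf: "g y = f y" if "y \<in> ball x \<delta>" for y
  proof -
    have s: "((\<lambda>\<alpha>. c \<alpha> * vmonom \<alpha> (y - a)) has_sum f y) UNIV"
      using ps sub that by (auto simp: power_series_on_def)
    have "(\<lambda>n. c (e n) * vmonom (e n) (y - a)) sums f y"
      using sums[OF has_sum_imp_summable[OF s]] infsumI[OF s] by simp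
    with g(1)[OF that] show ?thesis by (rule sums_unique2)
  qed
  have xb: "x \<in> ball x \<delta>" using d by simp
  have "(g has_derivative (\<lambda>h. \<Sum>i\<in>UNIV. h $ i * G i x)) (at x)"
    using g(2)[OF xb] unfolding at_within_open[OF xb open_ball] .
  then show "(f has_derivative (\<lambda>h. \<Sum>i\<in>UNIV. h $ i * (\<Sum>\<^sub>\<infinity>\<alpha>. c \<alpha> * vmonom_partial i \<alpha> (x - a)))) (at x)"
    unfolding G_def by (rule has_derivative_transform_within_open[of _ _ _ _ "ball x \<delta>"]) (use d gf in auto)
qed

section \<open>Higher partial derivatives of analytic functions\<close>

lemma has_derivative_imp_partial:
  assumes "(f has_derivative f') (at x)"
  shows "partial i f x = f' (axis i 1)"
proof -
  have "((\<lambda>t::real. x + t *\<^sub>R axis i 1) has_derivative (\<lambda>t. t *\<^sub>R axis i 1)) (at 0)"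
    by (auto intro!: derivative_eq_intros)
  then have "(f \<circ> (\<lambda>t::real. x + t *\<^sub>R axis i 1) has_derivative f' \<circ> (\<lambda>t. t *\<^sub>R axis i 1)) (at 0)"
    using assms by (intro diff_chain_at) auto
  moreover have "f' (t *\<^sub>R axis i 1) = t * f' (axis i 1)" for t
    using linear_scale[OF has_derivative_linear[OF assms]] by simp
  ultimately have "((\<lambda>t. f (x + t *\<^sub>R axis i 1)) has_field_derivative f' (axis i 1)) (at 0)"
    by (simp add: has_field_derivative_def o_def mult_commute_abs)
  then show ?thesis unfolding partial_def by (rule DERIV_imp_deriv)
qed

text \<open>Centre and radius survive differentiation, so the step can be iterated and one ball
  serves the derivatives of all orders.\<close>

lemma power_series_on_partial:
  fixes a x :: "real ^ 'n::finite"
  assumes ps: "power_series_on c a r f"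
  shows "power_series_on (coef_partial i c) a r (partial i f)"
    and "x \<in> ball a r \<Longrightarrow> (f has_derivative (\<lambda>h. \<Sum>i\<in>UNIV. h $ i * partial i f x)) (at x)"
proof -
  have p: "partial i f x = (\<Sum>\<^sub>\<infinity>\<alpha>. c \<alpha> * vmonom_partial i \<alpha> (x - a))" if x: "x \<in> ball a r" for x i
    unfolding has_derivative_imp_partial[OF power_series_on_has_derivative(1)[OF ps x]]
    by (simp add: axis_def if_distrib[of "\<lambda>t. t * _"] cong: if_cong)
  show "x \<in> ball a r \<Longrightarrow> (f has_derivative (\<lambda>h. \<Sum>i\<in>UNIV. h $ i * partial i f x)) (at x)"
    using power_series_on_has_derivative(1)[OF ps] by (simp add: p)
  show "power_series_on (coef_partial i c) a r (partial i f)"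
    unfolding power_series_on_def
  proof
    fix x assume x: "x \<in> ball a r"
    \<comment> \<open>Multi-indices outside the range of \<open>S\<close> have \<open>i\<close>-th
      entry 0, so their terms vanish after differentiation, and the rest is re-indexed along the
      injection \<open>S\<close>.\<close>
    define S where "S = (\<lambda>\<beta>::'n \<Rightarrow> nat. \<beta>(i := Suc (\<beta> i)))"
    have inj: "inj S"
    proof (rule injI)
      fix \<beta> \<gamma> assume "S \<beta> = S \<gamma>"
      then show "\<beta> = \<gamma>" unfolding S_def fun_eq_iff by (metis fun_upd_apply nat.inject)
    qed
    have range: "\<alpha> \<in> range S" if "\<alpha> i \<noteq> 0" for \<alpha>
      using that by (intro image_eqI[of _ _ "\<alpha>(i := \<alpha> i - 1)"]) (auto simp: S_def)
    have "((\<lambda>\<alpha>. c \<alpha> * vmonom_partial i \<alpha> (x - a)) has_sum partial i f x) UNIV"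
      using power_series_on_has_derivative(2)[OF ps x] p[OF x] by auto
    then have "((\<lambda>\<alpha>. c \<alpha> * vmonom_partial i \<alpha> (x - a)) has_sum partial i f x) (range S)"
      by (rule has_sum_cong_neutral[THEN iffD1, rotated -1])
         (use range in \<open>auto simp: vmonom_partial_def\<close>)
    then have "((\<lambda>\<beta>. c (S \<beta>) * vmonom_partial i (S \<beta>) (x - a)) has_sum partial i f x) UNIV"
      using has_sum_reindex[OF inj, of "\<lambda>\<alpha>. c \<alpha> * vmonom_partial i \<alpha> (x - a)"] by (simp add: o_def)
    then show "((\<lambda>\<beta>. coef_partial i c \<beta> * vmonom \<beta> (x - a)) has_sum partial i f x) UNIV"
      by (simp add: S_def vmonom_partial_Suc coef_partial_def algebra_simps)
  qed
qed

text \<open>Symmetry of mixed partial derivatives, obtained at the level of coefficients.\<close>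

lemma coef_partial_commute: "coef_partial i \<circ> coef_partial j = coef_partial j \<circ> coef_partial i"
  by (cases "i = j") (auto simp: fun_eq_iff coef_partial_def fun_upd_twist)

text \<open>
  Indexing partial derivatives by lists of directions instead of multi-indices turns Taylor's formula
  in several variables into the one-dimensional formula along a line.
\<close>

definition list_partial :: "'n list \<Rightarrow> (real ^ 'n \<Rightarrow> real) \<Rightarrow> real ^ 'n \<Rightarrow> real"
  where "list_partial js f = fold partial js f"

lemma power_series_on_list_partial:
  "power_series_on c a r f \<Longrightarrow> power_series_on (fold coef_partial js c) a r (list_partial js f)"
  unfolding list_partial_def by (induction js arbitrary: c f) (auto intro: power_series_on_partial)

text \<open>Around \<open>x\<close> both derivatives are sums of power series, and the coefficients
  coincide because the operators \<open>coef_partial i\<close> commute.\<close>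

lemma list_partial_perm:
  assumes "real_analytic_on f S" "mset js = mset ks" "x \<in> S"
  shows "list_partial js f x = list_partial ks f x"
proof -
  obtain r c where r: "r > 0" and ps: "power_series_on c x r f"
    using assms by (auto simp: real_analytic_on_def power_series_on_def vmonom_def)
  have eq: "fold coef_partial js c = fold coef_partial ks c"
    by (simp add: fold_multiset_equiv[OF coef_partial_commute assms(2)])
  have "x \<in> ball x r" using r by simp
  with power_series_on_list_partial[OF ps, of js] power_series_on_list_partial[OF ps, of ks]
  show ?thesis unfolding power_series_on_def eq using has_sum_unique by blast
qed

text \<open>\<open>fold\<close> handles the last entry last, so appending \<open>i\<close> means
  differentiating \<open>list_partial js f\<close> once more.\<close>

lemma list_partial_has_derivative:
  assumes "real_analytic_on f S" "x \<in> S"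
  shows "(list_partial js f has_derivative (\<lambda>h. \<Sum>i\<in>UNIV. h $ i * list_partial (js @ [i]) f x)) (at x)"
proof -
  obtain r c where r: "r > 0" and ps: "power_series_on c x r f"
    using assms by (auto simp: real_analytic_on_def power_series_on_def vmonom_def)
  from power_series_on_partial(2)[OF power_series_on_list_partial[OF ps]] r
  show ?thesis by (auto simp: list_partial_def)
qed

text \<open>Whichever enumeration of the coordinates \<open>SOME\<close> picks, the multi-index
  derivative runs through a list with the right number of copies of each direction, that is, a
  permutation of \<open>js\<close>.\<close>

lemma multi_partial_eq_list_partial:
  fixes js :: "'n::finite list"
  assumes "real_analytic_on f S" "x \<in> S"
  shows "multi_partial (\<lambda>i. count (mset js) i) f x = list_partial js f x"
proof -
  define ns :: "'n list" where "ns = (SOME js. distinct js \<and> set js = UNIV)"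
  have ns: "distinct ns" "set ns = UNIV"
    using someI_ex[of "\<lambda>js :: 'n list. distinct js \<and> set js = UNIV"] finite_distinct_list[of "UNIV :: 'n set"]
    unfolding ns_def by auto
  define \<alpha> where "\<alpha> = (\<lambda>i. count (mset js) i)"
  define L where "L = (\<lambda>xs. concat (map (\<lambda>i. replicate (\<alpha> i) i) xs))"
  have rep: "fold partial (replicate m i) g = (partial i ^^ m) g" for m i and g :: "real ^ 'n \<Rightarrow> real"
    by (induction m arbitrary: g) (auto simp: funpow_swap1)
  have fold: "fold (\<lambda>i. partial i ^^ \<alpha> i) xs g = list_partial (L xs) g" for xs and g :: "real ^ 'n \<Rightarrow> real"
    by (induction xs arbitrary: g) (auto simp: L_def list_partial_def rep)
  have "count (mset (L xs)) i = (if i \<in> set xs then \<alpha> i else 0)" if "distinct xs" for xs i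
    using that by (induction xs) (auto simp: L_def)
  then have "mset (L ns) = mset js" using ns by (simp add: multiset_eq_iff \<alpha>_def)
  then show ?thesis
    using list_partial_perm[OF assms(1) _ assms(2)] fold unfolding multi_partial_def ns_def \<alpha>_def by metis
qed

section \<open>Approximating polynomials by tanh neurons\<close>

text \<open>The composition of the forward difference operators with the given steps, a signed sum
  of values of \<open>u\<close> at \<open>t\<close> plus sums of sublists of steps.\<close>

fun iter_diff :: "real list \<Rightarrow> (real \<Rightarrow> real) \<Rightarrow> real \<Rightarrow> real"
  where "iter_diff [] u t = u t"
  | "iter_diff (s # ss) u t = iter_diff ss u (t + s) - iter_diff ss u t"

text \<open>The recursion applies the head step outermost, whereas the mean value induction applies
  it to \<open>u\<close> first; both agree because translations commute.\<close>

lemma iter_diff_shift_diff: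
  "iter_diff ss (\<lambda>t. u (t + s) - u t) t = iter_diff ss u (t + s) - iter_diff ss u t"
proof (induction ss arbitrary: t)
  case (Cons a ss)
  have eq: "t + a + s = t + s + a" by simp
  show ?case unfolding iter_diff.simps Cons.IH eq by simp
qed simp

text \<open>The mean value theorem for steps of either sign or zero, as the steps
  \<open>h * v $ i\<close> may be.\<close>

lemma increment_eq_deriv:
  fixes u u' :: "real \<Rightarrow> real"
  assumes "\<And>t. (u has_real_derivative u' t) (at t)"
  shows "\<exists>\<xi>. \<bar>\<xi> - t\<bar> \<le> \<bar>s\<bar> \<and> u (t + s) - u t = s * u' \<xi>"
proof -
  consider "s = 0" | "s > 0" | "s < 0" by linarith
  then show ?thesis
  proof cases
    case 1
    then show ?thesis by (intro exI[of _ t]) auto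
  next
    case 2
    then obtain z where "z > t" "z < t + s" "u (t + s) - u t = (t + s - t) * u' z"
      using MVT2[of t "t + s" u u'] assms by auto
    then show ?thesis by (intro exI[of _ z]) auto
  next
    case 3
    then obtain z where "z > t + s" "z < t" "u t - u (t + s) = (t - (t + s)) * u' z"
      using MVT2[of "t + s" t u u'] assms by auto
    then show ?thesis by (intro exI[of _ z]) auto
  qed
qed

text \<open>The increments \<open>U m (t + s) - U m t\<close> again form a sequence of successive
  derivatives, so the induction hypothesis applies to them; the mean value theorem then trades the
  remaining increment for a factor \<open>s\<close> and one more derivative.\<close>

lemma iter_diff_eq_deriv:
  fixes U :: "nat \<Rightarrow> real \<Rightarrow> real"
  assumes "\<And>m t. (U m has_real_derivative U (Suc m) t) (at t)"
  shows "\<exists>\<xi>. \<bar>\<xi> - t\<bar> \<le> (\<Sum>s\<leftarrow>ss. \<bar>s\<bar>) \<and> iter_diff ss (U 0) t = prod_list ss * U (length ss) \<xi>"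
  using assms
proof (induction ss arbitrary: U)
  case Nil
  then show ?case by (intro exI[of _ t]) auto
next
  case (Cons s ss)
  have "((\<lambda>t. U m (t + s) - U m t) has_real_derivative (U (Suc m) (t + s) - U (Suc m) t)) (at t)" for m t
    using DERIV_shift[of "U m" _ t s] Cons.prems by (intro DERIV_diff) (auto simp: add.commute)
  from Cons.IH[of "\<lambda>m t. U m (t + s) - U m t", OF this] obtain \<xi> where \<xi>: "\<bar>\<xi> - t\<bar> \<le> (\<Sum>s\<leftarrow>ss. \<bar>s\<bar>)"
    and eq: "iter_diff ss (\<lambda>t. U 0 (t + s) - U 0 t) t = prod_list ss * (U (length ss) (\<xi> + s) - U (length ss) \<xi>)"
    by blast
  obtain \<zeta> where \<zeta>: "\<bar>\<zeta> - \<xi>\<bar> \<le> \<bar>s\<bar>"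
      "U (length ss) (\<xi> + s) - U (length ss) \<xi> = s * U (Suc (length ss)) \<zeta>"
    using increment_eq_deriv[of "U (length ss)" "U (Suc (length ss))"] Cons.prems by blast
  have "\<bar>\<zeta> - t\<bar> \<le> (\<Sum>s\<leftarrow>s # ss. \<bar>s\<bar>)" using \<xi> \<zeta>(1) by simp
  moreover have "iter_diff (s # ss) (U 0) t = prod_list (s # ss) * U (length (s # ss)) \<zeta>"
    using eq \<zeta>(2) by (simp add: iter_diff_shift_diff)
  ultimately show ?case by blast
qed

lemma finite_order_le: "finite {k :: 'n::finite \<Rightarrow> nat. (\<Sum>i\<in>UNIV. k i) \<le> D}"
proof (rule finite_subset)
  show "{k :: 'n \<Rightarrow> nat. (\<Sum>i\<in>UNIV. k i) \<le> D} \<subseteq> PiE UNIV (\<lambda>_. {..D})"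
  proof
    fix k :: "'n \<Rightarrow> nat" assume k: "k \<in> {k. (\<Sum>i\<in>UNIV. k i) \<le> D}"
    have "k i \<le> D" for i using member_le_sum[of i UNIV k] k by simp
    then show "k \<in> PiE UNIV (\<lambda>_. {..D})" by auto
  qed
qed (auto intro: finite_PiE)

text \<open>Every step either stays at the node \<open>k0\<close> or raises one of its entries by
  one, so the order never exceeds \<open>D\<close>. The coefficients \<open>A\<close> do not depend
  on \<open>v\<close>, which lets them become output weights.\<close>

lemma iter_diff_in_span:
  assumes "(\<Sum>i\<in>UNIV. k0 i) + length js \<le> D"
  shows "\<exists>A. \<forall>u t v. iter_diff (map (\<lambda>i. h * v $ i) js) u (t + h * (\<Sum>i\<in>UNIV. real (k0 i) * v $ i))
     = (\<Sum>k | (\<Sum>i\<in>UNIV. k i) \<le> D. A k * u (t + h * (\<Sum>i\<in>UNIV. real (k i) * (v :: real ^ 'n::finite) $ i)))"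
  using assms
proof (induction js arbitrary: k0)
  case Nil
  then show ?case
    by (intro exI[of _ "\<lambda>k. if k = k0 then 1 else 0"])
       (auto simp: if_distrib[of "\<lambda>a. a * _"] sum.If_cases finite_order_le Int_absorb1 cong: if_cong)
next
  case (Cons j js)
  define k1 where "k1 = k0(j := Suc (k0 j))"
  have k1: "k1 i = k0 i + (if i = j then 1 else 0)" for i by (auto simp: k1_def)
  have "(\<Sum>i\<in>UNIV. k1 i) + length js \<le> D" using Cons.prems by (simp add: k1 sum.distrib)
  from Cons.IH[OF this] obtain A1 where A1: "\<And>u t v. iter_diff (map (\<lambda>i. h * v $ i) js) u (t + h * (\<Sum>i\<in>UNIV. real (k1 i) * v $ i))
     = (\<Sum>k | (\<Sum>i\<in>UNIV. k i) \<le> D. A1 k * u (t + h * (\<Sum>i\<in>UNIV. real (k i) * v $ i)))" by blast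
  have "(\<Sum>i\<in>UNIV. k0 i) + length js \<le> D" using Cons.prems by simp
  from Cons.IH[OF this] obtain A0 where A0: "\<And>u t v. iter_diff (map (\<lambda>i. h * v $ i) js) u (t + h * (\<Sum>i\<in>UNIV. real (k0 i) * v $ i))
     = (\<Sum>k | (\<Sum>i\<in>UNIV. k i) \<le> D. A0 k * u (t + h * (\<Sum>i\<in>UNIV. real (k i) * v $ i)))" by blast
  have s: "t + h * (\<Sum>i\<in>UNIV. real (k0 i) * v $ i) + h * v $ j = t + h * (\<Sum>i\<in>UNIV. real (k1 i) * v $ i)"
    for t and v :: "real ^ 'n"
    by (simp add: k1 sum.distrib algebra_simps if_distrib[of "\<lambda>a. _ * a"] if_distrib[of real] cong: if_cong)
  show ?case
    by (intro exI[of _ "\<lambda>k. A1 k - A0 k"]) (simp add: s A0 A1 left_diff_distrib sum_subtractf)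
qed

text \<open>Evaluated at \<open>tanh t\<close>, the \<open>m\<close>-th polynomial is the
  \<open>m\<close>-th derivative of tanh; the factor is \<open>1 - X^2\<close>, from the
  differential equation of tanh.\<close>

fun tanh_deriv_poly :: "nat \<Rightarrow> real poly"
  where "tanh_deriv_poly 0 = [:0, 1:]"
  | "tanh_deriv_poly (Suc m) = pderiv (tanh_deriv_poly m) * [:1, 0, -1:]"

lemma DERIV_tanh_deriv_poly:
  "((\<lambda>t. poly (tanh_deriv_poly m) (tanh t)) has_real_derivative poly (tanh_deriv_poly (Suc m)) (tanh t)) (at t)"
proof -
  have "(tanh has_real_derivative 1 - tanh t ^ 2) (at t)"
    by (auto intro!: derivative_eq_intros)
  from DERIV_chain2[OF poly_DERIV this] show ?thesis
    by (simp add: algebra_simps power2_eq_square)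
qed

text \<open>\<open>pderiv\<close> lowers the degree by one and the quadratic factor raises it by
  two. In particular no polynomial of the sequence is zero.\<close>

lemma degree_tanh_deriv_poly: "degree (tanh_deriv_poly m) = Suc m"
proof (induction m)
  case (Suc m)
  then have "pderiv (tanh_deriv_poly m) \<noteq> 0" by (simp add: pderiv_eq_0_iff)
  then have "degree (pderiv (tanh_deriv_poly m) * [:1, 0, -1:]) = Suc (Suc m)"
    using Suc by (subst degree_mult_eq) (auto simp: degree_pderiv)
  then show ?case by (simp only: tanh_deriv_poly.simps)
qed simp

text \<open>Finitely many nonzero polynomials have finitely many roots, and by injectivity tanh
  takes each root at most once, so only finitely many points are excluded.\<close>

lemma ex_tanh_derivs_nonzero: "\<exists>b. \<forall>m\<le>D. poly (tanh_deriv_poly m) (tanh b) \<noteq> 0"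
proof -
  have "finite (tanh -` {x. poly (tanh_deriv_poly m) x = 0})" for m
  proof (intro finite_vimageI poly_roots_finite)
    show "tanh_deriv_poly m \<noteq> 0" using degree_tanh_deriv_poly[of m] by auto
    show "inj (tanh :: real \<Rightarrow> real)" by (simp add: inj_def)
  qed
  then have "finite (\<Union>m\<le>D. tanh -` {x. poly (tanh_deriv_poly m) x = 0})" by blast
  then obtain b where "b \<notin> (\<Union>m\<le>D. tanh -` {x. poly (tanh_deriv_poly m) x = 0})"
    using ex_new_if_finite[OF infinite_UNIV_char_0] by blast
  then show ?thesis by auto
qed

section \<open>Uniform approximation of monomials and polynomials\<close>

lemma abs_prod_list_le_power:
  fixes v :: "real ^ 'n"
  shows "(\<And>i. \<bar>v $ i\<bar> \<le> B) \<Longrightarrow> 0 \<le> B \<Longrightarrow> \<bar>prod_list (map (($) v) js)\<bar> \<le> B ^ length js"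
  by (induction js) (auto simp: abs_mult intro!: mult_mono)

text \<open>The iterated difference divided by \<open>h ^ m * U m b\<close> is the monomial times
  \<open>U m \<xi> / U m b\<close>, a ratio close to 1 for small \<open>h\<close>. Stating this for
  all small \<open>h\<close> lets finitely many monomials share one step size.\<close>

lemma eventually_monomial_approx:
  assumes b: "poly (tanh_deriv_poly (length js)) (tanh b) \<noteq> 0" and D: "length js \<le> D" and "\<epsilon> > 0"
  shows "\<forall>\<^sub>F h in at_right 0. \<exists>A. \<forall>v :: real ^ 'n::finite. (\<forall>i. \<bar>v $ i\<bar> \<le> 1) \<longrightarrow>
    \<bar>prod_list (map (($) v) js) - (\<Sum>k | (\<Sum>i\<in>UNIV. k i) \<le> D. A k * tanh (b + h * (\<Sum>i\<in>UNIV. real (k i) * v $ i)))\<bar> \<le> \<epsilon>"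
proof -
  define m where "m = length js"
  define U where "U = (\<lambda>m t. poly (tanh_deriv_poly m) (tanh t))"
  have U0: "U 0 = tanh" by (simp add: U_def fun_eq_iff)
  have dU: "(U m has_real_derivative U (Suc m) t) (at t)" for m t
    unfolding U_def by (rule DERIV_tanh_deriv_poly)
  have Ub: "U m b \<noteq> 0" using b by (simp add: U_def m_def)
  have "isCont (U m) b" using dU DERIV_isCont by blast
  \<comment> \<open>The tolerance is relative to \<open>\<bar>U m b\<bar>\<close> because the
    difference will be divided by \<open>U m b\<close>.\<close>
  then obtain \<delta> where \<delta>: "\<delta> > 0" "\<And>\<xi>. \<bar>\<xi> - b\<bar> < \<delta> \<Longrightarrow> \<bar>U m \<xi> - U m b\<bar> < \<epsilon> * \<bar>U m b\<bar>"
    using Ub \<open>\<epsilon> > 0\<close> unfolding continuous_at_eps_delta by (metis real_norm_def dist_real_def mult_pos_pos zero_less_abs_iff)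
  \<comment> \<open>All steps together stay below \<open>h * real m\<close>; the summand 1 covers
    \<open>m = 0\<close>.\<close>
  have "\<forall>\<^sub>F h in at_right 0. 0 < h \<and> h < \<delta> / (real m + 1)"
    using \<delta>(1) by (auto simp: eventually_at_right_less intro!: eventually_conj eventually_at_right_real eventually_mono[OF eventually_at_right_real[of 0 "\<delta> / (real m + 1)"]])
  then show ?thesis
  proof eventually_elim
    case (elim h)
    then have h: "h > 0" "h * (real m + 1) < \<delta>" by (auto simp: field_simps)
    have "(\<Sum>i\<in>UNIV. (\<lambda>_::'n. 0::nat) i) + length js \<le> D" using D by simp
    from iter_diff_in_span[OF this, of h] obtain A where A: "\<And>u t v. iter_diff (map (\<lambda>i. h * v $ i) js) u t
       = (\<Sum>k | (\<Sum>i\<in>UNIV. k i) \<le> D. A k * u (t + h * (\<Sum>i\<in>UNIV. real (k i) * (v :: real ^ 'n) $ i)))"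
      by auto
    show ?case
    proof (intro exI[of _ "\<lambda>k. A k / (h ^ m * U m b)"] allI impI)
      fix v :: "real ^ 'n" assume v: "\<forall>i. \<bar>v $ i\<bar> \<le> 1"
      define P where "P = prod_list (map (($) v) js)"
      have P: "\<bar>P\<bar> \<le> 1" using abs_prod_list_le_power[of v 1 js] v by (simp add: P_def)
      obtain \<xi> where \<xi>: "\<bar>\<xi> - b\<bar> \<le> (\<Sum>s\<leftarrow>map (\<lambda>i. h * v $ i) js. \<bar>s\<bar>)"
        and eq: "iter_diff (map (\<lambda>i. h * v $ i) js) (U 0) b = prod_list (map (\<lambda>i. h * v $ i) js) * U m \<xi>"
        using iter_diff_eq_deriv[of U b "map (\<lambda>i. h * v $ i) js", OF dU] by (auto simp: m_def)
      have "(\<Sum>s\<leftarrow>map (\<lambda>i. h * v $ i) js. \<bar>s\<bar>) \<le> h * real m"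
        unfolding m_def
      proof (induction js)
        case (Cons i js)
        have "h * \<bar>v $ i\<bar> \<le> h * 1" using v h by (intro mult_left_mono) auto
        then have "h * \<bar>v $ i\<bar> + (\<Sum>s\<leftarrow>map (\<lambda>i. h * v $ i) js. \<bar>s\<bar>) \<le> h * 1 + h * real (length js)"
          using Cons by (rule add_mono)
        then show ?case using h by (simp add: abs_mult distrib_left)
      qed simp
      then have "\<bar>\<xi> - b\<bar> < \<delta>" using \<xi> h by (simp add: algebra_simps)
      then have e: "\<bar>U m \<xi> - U m b\<bar> < \<epsilon> * \<bar>U m b\<bar>" by (rule \<delta>(2))
      have "prod_list (map (\<lambda>i. h * v $ i) js) = h ^ m * P"
        unfolding P_def m_def by (induction js) (auto simp: algebra_simps)
      then have "(\<Sum>k | (\<Sum>i\<in>UNIV. k i) \<le> D. A k * tanh (b + h * (\<Sum>i\<in>UNIV. real (k i) * v $ i))) = h ^ m * P * U m \<xi>"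
        using eq A[where u=tanh and t=b and v=v] U0 by simp
      then have "(\<Sum>k | (\<Sum>i\<in>UNIV. k i) \<le> D. A k / (h ^ m * U m b) * tanh (b + h * (\<Sum>i\<in>UNIV. real (k i) * v $ i)))
          = P * U m \<xi> / U m b"
        using h by (simp add: sum_divide_distrib[symmetric])
      moreover have "\<bar>P - P * U m \<xi> / U m b\<bar> = \<bar>P\<bar> * (\<bar>U m \<xi> - U m b\<bar> / \<bar>U m b\<bar>)"
      proof -
        have "P - P * U m \<xi> / U m b = - (P * ((U m \<xi> - U m b) / U m b))"
          using Ub by (simp add: field_simps)
        then show ?thesis by (simp add: abs_mult)
      qed
      moreover have "\<dots> \<le> 1 * \<epsilon>"
        using P e Ub \<open>\<epsilon> > 0\<close> by (intro mult_mono) (auto simp: field_simps)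
      ultimately show "\<bar>prod_list (map (($) v) js) - (\<Sum>k | (\<Sum>i\<in>UNIV. k i) \<le> D. A k / (h ^ m * U m b) * tanh (b + h * (\<Sum>i\<in>UNIV. real (k i) * v $ i)))\<bar> \<le> \<epsilon>"
        unfolding P_def[symmetric] by simp
    qed
  qed
qed

text \<open>Lists that are permutations of each other give the same monomial, so \<open>p\<close>
  may spread one coefficient over several lists. The same \<open>b\<close> and \<open>h\<close>
  serve every list in \<open>J\<close>.\<close>

lemma polynomial_approx:
  fixes p :: "'n::finite list \<Rightarrow> real"
  assumes "finite J" and J: "\<And>js. js \<in> J \<Longrightarrow> length js \<le> D" and "\<epsilon> > 0"
  shows "\<exists>b h A. \<forall>v :: real ^ 'n. (\<forall>i. \<bar>v $ i\<bar> \<le> 1) \<longrightarrow>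
    \<bar>(\<Sum>js\<in>J. p js * prod_list (map (($) v) js))
      - (\<Sum>k | (\<Sum>i\<in>UNIV. k i) \<le> D. A k * tanh (b + h * (\<Sum>i\<in>UNIV. real (k i) * v $ i)))\<bar> \<le> \<epsilon>"
proof -
  obtain b where b: "\<And>m. m \<le> D \<Longrightarrow> poly (tanh_deriv_poly m) (tanh b) \<noteq> 0"
    using ex_tanh_derivs_nonzero by blast
  \<comment> \<open>The summand 1 keeps \<open>B\<close> positive when all coefficients
    vanish.\<close>
  define B where "B = (\<Sum>js\<in>J. \<bar>p js\<bar>) + 1"
  have B: "B > 0" unfolding B_def by (smt (verit) abs_ge_zero sum_nonneg)
  have "\<forall>\<^sub>F h in at_right 0. \<forall>js\<in>J. \<exists>A. \<forall>v :: real ^ 'n. (\<forall>i. \<bar>v $ i\<bar> \<le> 1) \<longrightarrow>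
    \<bar>prod_list (map (($) v) js) - (\<Sum>k | (\<Sum>i\<in>UNIV. k i) \<le> D. A k * tanh (b + h * (\<Sum>i\<in>UNIV. real (k i) * v $ i)))\<bar> \<le> \<epsilon> / B"
    using \<open>\<epsilon> > 0\<close> B b J \<open>finite J\<close> by (intro eventually_ball_finite ballI eventually_monomial_approx) auto
  then obtain h where "\<forall>js\<in>J. \<exists>A. \<forall>v :: real ^ 'n. (\<forall>i. \<bar>v $ i\<bar> \<le> 1) \<longrightarrow>
    \<bar>prod_list (map (($) v) js) - (\<Sum>k | (\<Sum>i\<in>UNIV. k i) \<le> D. A k * tanh (b + h * (\<Sum>i\<in>UNIV. real (k i) * v $ i)))\<bar> \<le> \<epsilon> / B"
    using eventually_happens'[OF trivial_limit_at_right_real] by blast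
  from bchoice[OF this] obtain A where A: "\<And>js v. js \<in> J \<Longrightarrow> (\<forall>i. \<bar>(v :: real ^ 'n) $ i\<bar> \<le> 1) \<Longrightarrow>
    \<bar>prod_list (map (($) v) js) - (\<Sum>k | (\<Sum>i\<in>UNIV. k i) \<le> D. A js k * tanh (b + h * (\<Sum>i\<in>UNIV. real (k i) * v $ i)))\<bar> \<le> \<epsilon> / B"
    by blast
  show ?thesis
  \<comment> \<open>The weights of all lists are added up node by node, so the number of neurons is
    the number of nodes \<open>k\<close>, however large \<open>J\<close> is.\<close>
  proof (rule exI[of _ b], rule exI[of _ h], rule exI[of _ "\<lambda>k. \<Sum>js\<in>J. p js * A js k"], intro allI impI)
    fix v :: "real ^ 'n" assume v: "\<forall>i. \<bar>v $ i\<bar> \<le> 1"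
    define T where "T k = tanh (b + h * (\<Sum>i\<in>UNIV. real (k i) * v $ i))" for k
    have "(\<Sum>k | (\<Sum>i\<in>UNIV. k i) \<le> D. (\<Sum>js\<in>J. p js * A js k) * T k) = (\<Sum>js\<in>J. p js * (\<Sum>k | (\<Sum>i\<in>UNIV. k i) \<le> D. A js k * T k))"
      unfolding sum_distrib_right sum_distrib_left by (subst sum.swap) (simp add: mult.assoc)
    then have "\<bar>(\<Sum>js\<in>J. p js * prod_list (map (($) v) js)) - (\<Sum>k | (\<Sum>i\<in>UNIV. k i) \<le> D. (\<Sum>js\<in>J. p js * A js k) * T k)\<bar>
       = \<bar>\<Sum>js\<in>J. p js * (prod_list (map (($) v) js) - (\<Sum>k | (\<Sum>i\<in>UNIV. k i) \<le> D. A js k * T k))\<bar>"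
      by (simp add: right_diff_distrib sum_subtractf)
    also have "\<dots> \<le> (\<Sum>js\<in>J. \<bar>p js\<bar> * (\<epsilon> / B))"
      unfolding T_def abs_mult
      by (intro order_trans[OF sum_abs] sum_mono) (simp only: abs_mult, intro mult_left_mono A v abs_ge_zero)
    also have "\<dots> = (\<Sum>js\<in>J. \<bar>p js\<bar>) * (\<epsilon> / B)" by (simp only: sum_distrib_right)
    also have "\<dots> \<le> B * (\<epsilon> / B)" using B \<open>\<epsilon> > 0\<close> by (intro mult_right_mono) (auto simp: B_def)
    also have "\<dots> = \<epsilon>" using B by simp
    finally show "\<bar>(\<Sum>js\<in>J. p js * prod_list (map (($) v) js))
      - (\<Sum>k | (\<Sum>i\<in>UNIV. k i) \<le> D. (\<Sum>js\<in>J. p js * A js k) * tanh (b + h * (\<Sum>i\<in>UNIV. real (k i) * v $ i)))\<bar> \<le> \<epsilon>"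
      unfolding T_def .
  qed
qed

section \<open>Counting neurons\<close>

text \<open>Stars and bars: the slack \<open>D - (\<Sum>i\<in>UNIV. k i)\<close>, put in front of
  the values of \<open>k\<close>, turns the inequality into an equation for lists of length
  \<open>Suc (CARD('n))\<close> with sum \<open>D\<close>.\<close>

lemma card_order_le: "card {k :: 'n::finite \<Rightarrow> nat. (\<Sum>i\<in>UNIV. k i) \<le> D} \<le> (D + CARD('n)) choose CARD('n)"
proof -
  obtain ns where ns: "set ns = (UNIV :: 'n set)" "distinct ns"
    using finite_distinct_list[of "UNIV :: 'n set"] by auto
  have len: "length ns = CARD('n)" using distinct_card[OF ns(2)] ns(1) by simp
  define L where "L = (\<lambda>k :: 'n \<Rightarrow> nat. (D - (\<Sum>i\<in>UNIV. k i)) # map k ns)"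
  define T where "T = {l :: nat list. length l = Suc (CARD('n)) \<and> sum_list l = D}"
  have "T \<subseteq> {l. set l \<subseteq> {..D} \<and> length l = Suc (CARD('n))}"
    unfolding T_def by (auto dest: member_le_sum_list)
  then have "finite T" by (rule finite_subset) (simp add: finite_lists_length_eq)
  moreover have "L ` {k. (\<Sum>i\<in>UNIV. k i) \<le> D} \<subseteq> T"
    using ns len by (auto simp: L_def T_def sum_list_distinct_conv_sum_set)
  moreover have "inj L"
    using ns by (auto simp: L_def inj_def)
  ultimately have "card {k :: 'n \<Rightarrow> nat. (\<Sum>i\<in>UNIV. k i) \<le> D} \<le> card T"
    by (meson card_inj_on_le inj_on_subset subset_UNIV)
  also have "card T = (D + CARD('n)) choose CARD('n)"
    unfolding T_def card_length_sum_list using binomial_symmetric[of D "D + CARD('n)"] by simp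
  finally show ?thesis .
qed

lemma real_binomial_of_nat: "real_binomial (real D) d = real ((D + d) choose d)"
proof (induction d)
  case (Suc d)
  have "((D + Suc d) choose Suc d) * Suc d = (D + Suc d) * ((D + d) choose d)"
    using Suc_times_binomial_eq[of "D + d" d] by (simp only: add_Suc_right)
  then have "real ((D + Suc d) choose Suc d) * real (Suc d) = real (D + Suc d) * real ((D + d) choose d)"
    by (simp only: of_nat_mult[symmetric])
  then have "real ((D + Suc d) choose Suc d) = real ((D + d) choose d) * (real (D + Suc d) / real (Suc d))"
    by (simp only: eq_divide_eq times_divide_eq_right mult.commute) simp
  also have "\<dots> = real_binomial (real D) (Suc d)"
    by (simp add: real_binomial_def flip: Suc)
  finally show ?case ..
qed (simp add: real_binomial_def)

lemma real_binomial_mono: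
  assumes "0 \<le> x" "x \<le> y"
  shows "real_binomial x d \<le> real_binomial y d"
  unfolding real_binomial_def using assms by (intro prod_mono) (auto intro!: divide_right_mono)

text \<open>Neurons indexed by \<open>K\<close> are renumbered by an enumeration \<open>e\<close>;
  those from \<open>card K\<close> up to \<open>l\<close> get output weight 0.\<close>

lemma ex_tanh_neurons:
  fixes w :: "'k \<Rightarrow> real ^ 'n::finite"
  assumes "finite K" "card K \<le> l"
  shows "\<exists>W1 b1 W2. \<forall>x. (\<Sum>j<l. W2 j * tanh ((\<Sum>i\<in>UNIV. W1 j $ i * x $ i) + b1 j))
      = (\<Sum>k\<in>K. A k * tanh ((\<Sum>i\<in>UNIV. w k $ i * x $ i) + \<beta> k))"
proof -
  obtain e where e: "bij_betw e {..<card K} K"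
    using ex_bij_betw_nat_finite[OF assms(1)] by (auto simp: atLeast0LessThan)
  show ?thesis
  proof (intro exI allI)
    fix x :: "real ^ 'n"
    have "(\<Sum>j<l. (if j < card K then A (e j) else 0) * tanh ((\<Sum>i\<in>UNIV. w (e j) $ i * x $ i) + \<beta> (e j)))
       = (\<Sum>j<card K. A (e j) * tanh ((\<Sum>i\<in>UNIV. w (e j) $ i * x $ i) + \<beta> (e j)))"
      using assms(2) by (intro sum.mono_neutral_cong_right) auto
    also have "\<dots> = (\<Sum>k\<in>K. A k * tanh ((\<Sum>i\<in>UNIV. w k $ i * x $ i) + \<beta> k))"
      using e by (rule sum.reindex_bij_betw)
    finally show "(\<Sum>j<l. (if j < card K then A (e j) else 0) * tanh ((\<Sum>i\<in>UNIV. w (e j) $ i * x $ i) + \<beta> (e j)))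
       = (\<Sum>k\<in>K. A k * tanh ((\<Sum>i\<in>UNIV. w k $ i * x $ i) + \<beta> k))" .
  qed
qed

section \<open>The Taylor polynomial\<close>

text \<open>The seminorm controls the derivative only almost everywhere. By continuity the points of
  the open box that violate the bound form an open set, and an open null set is empty.\<close>

lemma list_partial_le_Sobolev_seminorm:
  fixes f :: "real ^ 'n::finite \<Rightarrow> real"
  assumes f: "real_analytic_on f \<Omega>" and sub: "cbox a b \<subseteq> \<Omega>"
    and B: "Sobolev_seminorm (length js) (cbox a b) f \<le> ereal B" and x: "x \<in> box a b"
  shows "\<bar>list_partial js f x\<bar> \<le> B"
proof -
  define \<alpha> where "\<alpha> = (\<lambda>i. count (mset js) i)"
  have "sum \<alpha> UNIV = sum \<alpha> (set_mset (mset js))"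
    unfolding \<alpha>_def by (intro sum.mono_neutral_right) (auto simp: not_in_iff)
  also have "\<dots> = length js"
    unfolding \<alpha>_def size_multiset_overloaded_eq[symmetric] by simp
  finally have \<alpha>: "sum \<alpha> UNIV = length js" .
  have "finite {\<beta> :: 'n \<Rightarrow> nat. sum \<beta> UNIV = length js}"
    by (rule finite_subset[OF _ finite_order_le[of "length js"]]) auto
  then have "Linf_norm (cbox a b) (multi_partial \<alpha> f) \<le> Sobolev_seminorm (length js) (cbox a b) f"
    unfolding Sobolev_seminorm_def using \<alpha> by (intro Max_ge) auto
  then have le: "Linf_norm (cbox a b) (multi_partial \<alpha> f) \<le> ereal B" using B by (rule order_trans)
  have "AE x in lebesgue_on (cbox a b). ereal \<bar>multi_partial \<alpha> f x\<bar> \<le> ereal B"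
    using esssup_AE[of "\<lambda>x. ereal \<bar>multi_partial \<alpha> f x\<bar>" "lebesgue_on (cbox a b)"] 
    by eventually_elim (rule order_trans[OF _ le[unfolded Linf_norm_def]])
  then have "AE x in lebesgue. x \<in> cbox a b \<longrightarrow> \<bar>multi_partial \<alpha> f x\<bar> \<le> B"
    by (subst (asm) AE_restrict_space_iff) auto
  then obtain N where N: "N \<in> null_sets lebesgue" "{x. \<not> (x \<in> cbox a b \<longrightarrow> \<bar>multi_partial \<alpha> f x\<bar> \<le> B)} \<subseteq> N"
    unfolding eventually_ae_filter by auto
  define T where "T = box a b \<inter> list_partial js f -` {y. \<bar>y\<bar> > B}"
  have bx: "box a b \<subseteq> \<Omega>" using sub box_subset_cbox by blast
  have "continuous_on (box a b) (list_partial js f)"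
  proof (intro continuous_at_imp_continuous_on ballI)
    fix x assume "x \<in> box a b"
    then show "isCont (list_partial js f) x"
      using list_partial_has_derivative[OF f] bx has_derivative_continuous by blast
  qed
  moreover have "open {y :: real. \<bar>y\<bar> > B}"
    by (intro open_Collect_less continuous_intros)
  ultimately have "open T" unfolding T_def by (intro continuous_open_preimage) auto
  moreover have "T \<subseteq> N"
  proof
    fix y assume y: "y \<in> T"
    then have "multi_partial \<alpha> f y = list_partial js f y"
      unfolding \<alpha>_def T_def using multi_partial_eq_list_partial[OF f] bx by auto
    then show "y \<in> N" using N(2) y box_subset_cbox[of a b] by (auto simp: T_def)
  qed
  then have "negligible T"
    using N(1) negligible_subset by (auto simp: negligible_iff_null_sets)
  ultimately have "T = {}" using open_not_negligible by blast
  then show ?thesis using x by (auto simp: T_def not_less)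
qed

lemma finite_lists_length_less_UNIV: "finite {js :: 'n::finite list. length js < s}"
  by (rule finite_subset[OF _ finite_lists_length_le[of "UNIV :: 'n set" s]]) auto

lemma sum_lists_length_Suc:
  fixes g :: "'n::finite list \<Rightarrow> real"
  shows "(\<Sum>js | length js = Suc m. g js) = (\<Sum>js | length js = m. \<Sum>i\<in>UNIV. g (js @ [i]))"
proof -
  have "bij_betw (\<lambda>(js, i). js @ [i]) ({js. length js = m} \<times> UNIV) {js :: 'n list. length js = Suc m}"
    by (rule bij_betw_byWitness[where f' = "\<lambda>js. (butlast js, last js)"])
       (auto simp: length_Suc_conv_rev)
  from sum.reindex_bij_betw[OF this, of g] show ?thesis
    by (simp add: sum.cartesian_product case_prod_unfold)
qed

text \<open>Starting from \<open>m = 0\<close>, this yields all derivatives of \<open>f\<close>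
  along a line. Every ordering of the directions occurs as its own list, so no multinomial
  coefficients appear.\<close>

lemma list_partial_along_line:
  fixes c v :: "real ^ 'n::finite"
  assumes "real_analytic_on f \<Omega>" "c + t *\<^sub>R v \<in> \<Omega>"
  shows "((\<lambda>t. \<Sum>js | length js = m. prod_list (map (($) v) js) * list_partial js f (c + t *\<^sub>R v)) has_real_derivative
     (\<Sum>js | length js = Suc m. prod_list (map (($) v) js) * list_partial js f (c + t *\<^sub>R v))) (at t)"
proof -
  have "((\<lambda>t. list_partial js f (c + t *\<^sub>R v)) has_real_derivative
     (\<Sum>i\<in>UNIV. v $ i * list_partial (js @ [i]) f (c + t *\<^sub>R v))) (at t)" for js
  proof -
    have "((\<lambda>t. c + t *\<^sub>R v) has_derivative (\<lambda>s. s *\<^sub>R v)) (at t)"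
      by (auto intro!: derivative_eq_intros)
    from diff_chain_at[OF this list_partial_has_derivative[OF assms, of js]]
    show ?thesis
      unfolding has_field_derivative_def o_def
      by (rule has_derivative_eq_rhs) (simp add: fun_eq_iff sum_distrib_left ac_simps)
  qed
  then show ?thesis
    unfolding sum_lists_length_Suc
    by (intro DERIV_cong[OF DERIV_sum[OF DERIV_cmult]]) (auto simp: sum_distrib_left ac_simps)
qed

text \<open>Lagrange's remainder on the segment from \<open>c\<close> to \<open>x\<close>: there are
  \<open>CARD('n) ^ s\<close> lists of length \<open>s\<close>, and each contributes at most
  \<open>(1 / 2) ^ s * B\<close>, since the coordinates of \<open>x - c\<close> are at most 1/2 in
  absolute value.\<close>

lemma taylor_polynomial_error:
  fixes f :: "real ^ 'n::finite \<Rightarrow> real"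
  assumes f: "real_analytic_on f \<Omega>" and sub: "unit_cube \<subseteq> \<Omega>"
    and B: "\<And>js x. length js = s \<Longrightarrow> x \<in> box 0 1 \<Longrightarrow> \<bar>list_partial js f x\<bar> \<le> B"
    and x: "x \<in> unit_cube" and c: "c = (\<chi> i. 1 / 2)" and "0 < s"
  shows "\<bar>f x - (\<Sum>js | length js < s. list_partial js f c / fact (length js) * prod_list (map (($) (x - c)) js))\<bar>
     \<le> (real CARD('n) / 2) ^ s * B / fact s"
proof -
  define v where "v = x - c"
  define \<phi> where "\<phi> m t = (\<Sum>js | length js = m. prod_list (map (($) v) js) * list_partial js f (c + t *\<^sub>R v))" for m t
  have x01: "0 \<le> x $ i" "x $ i \<le> 1" for i using x by (auto simp: mem_box_cart)
  have v: "\<bar>v $ i\<bar> \<le> 1 / 2" for i 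
  proof -
    have "v $ i = x $ i - 1 / 2" by (simp add: v_def c)
    then show ?thesis using x01[of i] by linarith
  qed
  have comp: "(c + t *\<^sub>R v) $ i = (1 - t) / 2 + t * x $ i" for t i
    by (simp add: c v_def field_simps)
  have cube: "c + t *\<^sub>R v \<in> unit_cube" if "0 \<le> t" "t \<le> 1" for t
  proof -
    have t: "0 \<le> t * x $ i" "t * x $ i \<le> t" for i
      using x01 that mult_left_mono[of "x $ i" 1 t] by auto
    have "0 \<le> (1 - t) / 2 + t * x $ i" "(1 - t) / 2 + t * x $ i \<le> 1" for i
      using t[of i] that by (auto simp: field_simps)
    then show ?thesis unfolding mem_box_cart comp by simp
  qed
  \<comment> \<open>Even if \<open>x\<close> lies on the boundary, the points strictly between
    \<open>c\<close> and \<open>x\<close> are interior, where the bound \<open>B\<close> is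
    available.\<close>
  have inner: "c + t *\<^sub>R v \<in> box 0 1" if "0 < t" "t < 1" for t
  proof -
    have t: "0 \<le> t * x $ i" "t * x $ i \<le> t" for i
      using x01 that mult_left_mono[of "x $ i" 1 t] by auto
    have "0 < (1 - t) / 2 + t * x $ i" for i
      using t[of i] that by (simp add: add_pos_nonneg)
    moreover have "(1 - t) / 2 + t * x $ i < 1" for i
    proof -
      have "(1 - t) / 2 + t * x $ i \<le> (1 - t) / 2 + t" using t[of i] by simp
      also have "\<dots> < 1" using that by (simp add: field_simps)
      finally show ?thesis .
    qed
    ultimately show ?thesis unfolding mem_box_cart comp by simp
  qed
  have single: "\<phi> 0 t = f (c + t *\<^sub>R v)" for t
    by (simp add: \<phi>_def list_partial_def)
  have fx: "\<phi> 0 1 = f x" by (simp add: single v_def)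
  have "\<exists>t. 0 < t \<and> t < 1 \<and> \<phi> 0 1 = (\<Sum>m<s. \<phi> m 0 / fact m * 1 ^ m) + \<phi> s t / fact s * 1 ^ s"
  proof (intro Maclaurin \<open>0 < s\<close> allI impI)
    fix m t assume "m < s \<and> 0 \<le> t \<and> t \<le> (1 :: real)"
    then show "(\<phi> m has_real_derivative \<phi> (Suc m) t) (at t)"
      unfolding \<phi>_def using cube[of t] sub by (intro list_partial_along_line[OF f]) auto
  qed auto
  then obtain t where t: "0 < t" "t < 1" and eq: "f x = (\<Sum>m<s. \<phi> m 0 / fact m) + \<phi> s t / fact s"
    using fx by auto
  have "(\<Sum>m<s. \<phi> m 0 / fact m) = (\<Sum>m<s. \<Sum>js | length js = m. list_partial js f c / fact (length js) * prod_list (map (($) v) js))"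
    unfolding \<phi>_def sum_divide_distrib by (intro sum.cong) (auto simp: ac_simps)
  also have "\<dots> = (\<Sum>m<s. \<Sum>js | js \<in> {js. length js < s} \<and> length js = m. list_partial js f c / fact (length js) * prod_list (map (($) v) js))"
    by (intro sum.cong) auto
  also have "\<dots> = (\<Sum>js | length js < s. list_partial js f c / fact (length js) * prod_list (map (($) v) js))"
    by (intro sum.group finite_lists_length_less_UNIV) auto
  finally have "f x - (\<Sum>js | length js < s. list_partial js f c / fact (length js) * prod_list (map (($) v) js)) = \<phi> s t / fact s"
    using eq by simp
  moreover have "\<bar>\<phi> s t\<bar> \<le> (real CARD('n) / 2) ^ s * B"
  proof -
    have "\<bar>\<phi> s t\<bar> \<le> (\<Sum>js :: 'n list | length js = s. (1 / 2) ^ s * B)"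
      unfolding \<phi>_def
    proof (intro order_trans[OF sum_abs] sum_mono)
      fix js :: "'n list" assume js: "js \<in> {js. length js = s}"
      have "\<bar>prod_list (map (($) v) js)\<bar> \<le> (1 / 2) ^ s"
        using abs_prod_list_le_power[of v "1/2" js] v js by auto
      moreover have "\<bar>list_partial js f (c + t *\<^sub>R v)\<bar> \<le> B"
        using B[of js] inner[OF t] js by auto
      ultimately show "\<bar>prod_list (map (($) v) js) * list_partial js f (c + t *\<^sub>R v)\<bar> \<le> (1 / 2) ^ s * B"
        unfolding abs_mult by (intro mult_mono) auto
    qed
    also have "\<dots> = (real CARD('n) / 2) ^ s * B"
      using card_lists_length_eq[of "UNIV :: 'n set" s] by (simp add: power_divide)
    finally show ?thesis .
  qed
  ultimately show ?thesis unfolding v_def by (simp add: divide_right_mono)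
qed

text \<open>A single term of the exponential series.\<close>

lemma power_over_fact_le_exp: "0 \<le> x \<Longrightarrow> x ^ n / fact n \<le> exp (x :: real)"
  using sum_le_suminf[of "\<lambda>k. x ^ k / fact k" "{n}"] summable_exp_generic[of x]
  by (simp add: exp_def divide_inverse mult.commute)

text \<open>The strict inequality leaves room for the error of replacing the polynomial by neurons.
  It rests on \<open>exp 1 / 10 < exp (- 1)\<close>, which follows from
  \<open>exp 1 \<le> 3\<close>.\<close>

lemma taylor_error_less_exp:
  fixes C :: real
  assumes "C > 0" "s > 0" "real N \<le> real s" "5 * C * real d \<le> real s"
  shows "(real d / 2) ^ s * C ^ s / fact s < exp (- real N)"
proof -
  have "(real d / 2) ^ s * C ^ s = (real d / 2 * C) ^ s" by (simp only: power_mult_distrib)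
  also have "\<dots> \<le> (real s / 10) ^ s" using assms by (intro power_mono) auto
  finally have "(real d / 2) ^ s * C ^ s / fact s \<le> (real s / 10) ^ s / fact s"
    by (rule divide_right_mono) simp
  also have "\<dots> = (real s ^ s / fact s) / 10 ^ s" by (simp add: power_divide)
  also have "\<dots> \<le> exp (real s) / 10 ^ s"
    using power_over_fact_le_exp[of "real s" s] by (intro divide_right_mono) auto
  also have "\<dots> = (exp 1 / 10) ^ s" by (simp add: power_divide flip: exp_of_nat_mult)
  also have "\<dots> < exp (- 1) ^ s"
  proof (rule power_strict_mono)
    have "exp 1 * exp 1 \<le> (3 :: real) * 3" using exp_le by (intro mult_mono) auto
    then have "exp (1 :: real) * exp 1 < 10" by simp
    then show "exp 1 / 10 < exp (- 1 :: real)" by (simp add: exp_minus field_simps)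
  qed (use assms in auto)
  also have "\<dots> = exp (- real s)" by (simp flip: exp_of_nat_mult)
  also have "\<dots> \<le> exp (- real N)" using assms by simp
  finally show ?thesis .
qed

text \<open>The error budget \<open>exp (- real N)\<close> is split into \<open>E\<close> for the
  Taylor polynomial and the positive rest for the network. Any width \<open>l\<close> above the
  dimension and the node count is allowed, so that both prescribed widths are covered.\<close>

lemma ex_shallow_tanh_net:
  fixes f :: "real ^ 'n::finite \<Rightarrow> real"
  assumes f: "real_analytic_on f \<Omega>" and sub: "unit_cube \<subseteq> \<Omega>" and C: "C > 0"
    and B: "Sobolev_seminorm (Suc D) unit_cube f \<le> ereal (C ^ Suc D)"
    and D: "real N + 5 * C * real CARD('n) \<le> real (Suc D)"
    and l: "CARD('n) \<le> l" "(D + CARD('n)) choose CARD('n) \<le> l"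
  shows "\<exists>g :: real ^ 'n \<Rightarrow> real ^ 1. is_shallow_tanh_net l g \<and>
       Linf_norm unit_cube (\<lambda>x. f x - g x $ 1) \<le> ereal (exp (- real N))"
proof -
  define c :: "real ^ 'n" where "c = (\<chi> i. 1 / 2)"
  define p where "p = (\<lambda>js. list_partial js f c / fact (length js))"
  define E where "E = (real CARD('n) / 2) ^ Suc D * C ^ Suc D / fact (Suc D)"
  have "5 * C * real CARD('n) \<ge> 0" using C by simp
  then have "E < exp (- real N)"
    unfolding E_def using C D by (intro taylor_error_less_exp) linarith+
  then have \<epsilon>: "exp (- real N) - E > 0" by simp
  define K where "K = {k :: 'n \<Rightarrow> nat. (\<Sum>i\<in>UNIV. k i) \<le> D}"
  obtain b h A where A: "\<And>v :: real ^ 'n. (\<forall>i. \<bar>v $ i\<bar> \<le> 1) \<Longrightarrow>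
    \<bar>(\<Sum>js | length js < Suc D. p js * prod_list (map (($) v) js))
      - (\<Sum>k\<in>K. A k * tanh (b + h * (\<Sum>i\<in>UNIV. real (k i) * v $ i)))\<bar> \<le> exp (- real N) - E"
    unfolding K_def
    using polynomial_approx[OF finite_lists_length_less_UNIV[of "Suc D"] _ \<epsilon>, of D p] by auto
  have "card K \<le> l" unfolding K_def using card_order_le[of D] l(2) by (rule order_trans)
  \<comment> \<open>The recentring at \<open>c\<close> is moved into the bias: the neuron of
    \<open>k\<close> has input weights \<open>h * real (k i)\<close> and loses \<open>h\<close>
    times the product of \<open>k\<close> with \<open>c\<close>.\<close>
  from ex_tanh_neurons[OF _ this, of A "\<lambda>k. \<chi> i. h * real (k i)" "\<lambda>k. b - h * (\<Sum>i\<in>UNIV. real (k i) * c $ i)"] finite_order_le[of D]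
  obtain W1 b1 W2 where W: "\<And>x. (\<Sum>j<l. W2 j * tanh ((\<Sum>i\<in>UNIV. W1 j $ i * x $ i) + b1 j))
      = (\<Sum>k\<in>K. A k * tanh ((\<Sum>i\<in>UNIV. (\<chi> i. h * real (k i)) $ i * x $ i) + (b - h * (\<Sum>i\<in>UNIV. real (k i) * c $ i))))"
    unfolding K_def by auto
  define g :: "real ^ 'n \<Rightarrow> real ^ 1" where "g = shallow_tanh_net l W1 b1 (\<chi> _. W2) 0"
  have g1: "g x $ 1 = (\<Sum>j<l. W2 j * tanh ((\<Sum>i\<in>UNIV. W1 j $ i * x $ i) + b1 j))" for x
    by (simp add: g_def shallow_tanh_net_def)
  have g: "g x $ 1 = (\<Sum>k\<in>K. A k * tanh (b + h * (\<Sum>i\<in>UNIV. real (k i) * (x - c) $ i)))" for x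
    unfolding g1 W by (simp add: right_diff_distrib sum_subtractf sum_distrib_left algebra_simps)
  have l1: "1 \<le> l" using l(1) zero_less_card_finite[where 'a = 'n] by linarith
  have net: "is_shallow_tanh_net l g"
    unfolding is_shallow_tanh_net_def using l(1) l1
    by (intro exI[of _ l] exI[of _ W1] exI[of _ b1] exI[of _ "\<chi> _. W2"] exI[of _ 0]) (auto simp: g_def)
  have err: "\<bar>f x - g x $ 1\<bar> \<le> exp (- real N)" if x: "x \<in> unit_cube" for x
  proof -
    have "\<bar>f x - (\<Sum>js | length js < Suc D. p js * prod_list (map (($) (x - c)) js))\<bar> \<le> E"
      unfolding p_def E_def
      by (rule taylor_polynomial_error[OF f sub _ x c_def zero_less_Suc])
         (use list_partial_le_Sobolev_seminorm[OF f sub] B in auto)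
    moreover have "\<forall>i. \<bar>(x - c) $ i\<bar> \<le> 1"
    proof
      fix i
      have "0 \<le> x $ i" "x $ i \<le> 1" using x by (auto simp: mem_box_cart)
      then show "\<bar>(x - c) $ i\<bar> \<le> 1" by (simp add: c_def abs_le_iff)
    qed
    from A[OF this] have "\<bar>(\<Sum>js | length js < Suc D. p js * prod_list (map (($) (x - c)) js)) - g x $ 1\<bar> \<le> exp (- real N) - E"
      unfolding g .
    ultimately show ?thesis by linarith
  qed
  \<comment> \<open>Continuity makes the error measurable, on which the bound for
    \<open>esssup\<close> rests.\<close>
  have "continuous_on unit_cube f"
  proof (intro continuous_at_imp_continuous_on ballI)
    fix x :: "real ^ 'n" assume "x \<in> unit_cube"
    then show "isCont f x"
      using list_partial_has_derivative[OF f, of x "[]"] sub has_derivative_continuous[of f]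
      by (auto simp: list_partial_def)
  qed
  moreover have "continuous_on unit_cube (\<lambda>x. g x $ 1)"
    unfolding g1 by (intro continuous_intros) auto
  ultimately have "(\<lambda>x. f x - g x $ 1) \<in> borel_measurable (lebesgue_on unit_cube)"
    by (intro continuous_imp_measurable_on_sets_lebesgue continuous_on_diff) auto
  then have "Linf_norm unit_cube (\<lambda>x. f x - g x $ 1) \<le> ereal (exp (- real N))"
    unfolding Linf_norm_def using err by (intro esssup_I AE_I2) (auto simp: space_restrict_space)
  with net show ?thesis by blast
qed

section \<open>Choice of the degree and comparison with the prescribed widths\<close>

theorem corollary5p8:
  fixes f :: "real ^ 'n \<Rightarrow> real" and \<Omega> :: "(real ^ 'n) set" and C :: real
  defines "d \<equiv> CARD('n)"
  assumes "open \<Omega>" and "unit_cube \<subseteq> \<Omega>"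
    and "real_analytic_on f \<Omega>"
    and "C > 0"
    and "\<forall>s::nat. s \<ge> 1 \<longrightarrow> Sobolev_seminorm s unit_cube f \<le> ereal (C ^ s)"
  shows "\<forall>N::nat. N \<ge> 1 \<longrightarrow>
    (\<exists>w (g :: real ^ 'n \<Rightarrow> real ^ 1).
       int w = \<lfloor>3 * real_of_int \<lceil>(real N + 5 * C * real d) / 2\<rceil>
                 * real_binomial (real N + 5 * C * real d) d\<rfloor> \<and>
       is_shallow_tanh_net w g \<and>
       Linf_norm unit_cube (\<lambda>x. f x - g x $ 1) \<le> ereal (exp (- real N))) \<and>
    (d = 1 \<longrightarrow>
     (\<exists>w (g :: real ^ 'n \<Rightarrow> real ^ 1).
       int w = 3 * \<lceil>(real N + 5 * C) / 2\<rceil> \<and>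
       is_shallow_tanh_net w g \<and>
       Linf_norm unit_cube (\<lambda>x. f x - g x $ 1) \<le> ereal (exp (- real N))))"
proof (intro allI impI)
  fix N :: nat assume N: "N \<ge> 1"
  define x where "x = real N + 5 * C * real d"
  have x1: "x \<ge> 1" using N \<open>C > 0\<close> unfolding x_def by (smt (verit) mult_nonneg_nonneg of_nat_0_le_iff of_nat_1 of_nat_mono)
  \<comment> \<open>Rounding down serves both sides: \<open>real D \<le> x\<close> bounds the node
    count by the real binomial, and \<open>x \<le> real (Suc D)\<close> gives the remainder of order
    \<open>Suc D\<close> its size.\<close>
  define D where "D = nat \<lfloor>x\<rfloor>"
  have D: "real D \<le> x" "x \<le> real (Suc D)" using x1 by (simp_all add: D_def) linarith+
  define m where "m = \<lceil>x / 2\<rceil>"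
  have m: "m \<ge> 1" "x / 2 \<le> m" using x1 by (auto simp: m_def)
  have net: "\<exists>g :: real ^ 'n \<Rightarrow> real ^ 1. is_shallow_tanh_net w g \<and>
       Linf_norm unit_cube (\<lambda>x. f x - g x $ 1) \<le> ereal (exp (- real N))"
    if "d \<le> w" "(D + d) choose d \<le> w" for w
    using assms that D(2) unfolding d_def x_def by (intro ex_shallow_tanh_net) auto
  show "(\<exists>w (g :: real ^ 'n \<Rightarrow> real ^ 1).
       int w = \<lfloor>3 * real_of_int \<lceil>(real N + 5 * C * real d) / 2\<rceil>
                 * real_binomial (real N + 5 * C * real d) d\<rfloor> \<and>
       is_shallow_tanh_net w g \<and>
       Linf_norm unit_cube (\<lambda>x. f x - g x $ 1) \<le> ereal (exp (- real N))) \<and>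
    (d = 1 \<longrightarrow>
     (\<exists>w (g :: real ^ 'n \<Rightarrow> real ^ 1).
       int w = 3 * \<lceil>(real N + 5 * C) / 2\<rceil> \<and>
       is_shallow_tanh_net w g \<and>
       Linf_norm unit_cube (\<lambda>x. f x - g x $ 1) \<le> ereal (exp (- real N))))"
  proof (intro conjI impI)
    define q where "q = 3 * real_of_int m * real_binomial x d"
    \<comment> \<open>Comparison with the argument 1, where the binomial is \<open>d + 1\<close>;
      this makes the width at least the input dimension.\<close>
    have b1: "real (d + 1) \<le> real_binomial x d"
      using real_binomial_mono[of "real 1" x d] x1 unfolding real_binomial_of_nat by simp
    have b2: "real ((D + d) choose d) \<le> real_binomial x d"
      using real_binomial_mono[of "real D" x d] D(1) unfolding real_binomial_of_nat by simp
    have "1 * real_binomial x d \<le> q"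
      unfolding q_def using m b1 by (intro mult_right_mono) auto
    then have "real d \<le> q" "real ((D + d) choose d) \<le> q" using b1 b2 by auto
    \<comment> \<open>Both lower bounds are integers, so they survive rounding \<open>q\<close>
      down.\<close>
    then have "d \<le> nat \<lfloor>q\<rfloor>" "(D + d) choose d \<le> nat \<lfloor>q\<rfloor>" "0 \<le> \<lfloor>q\<rfloor>" 
      using of_nat_0_le_iff[of d, where 'a = real] by (auto simp: le_nat_floor intro: order_trans)
    with net[of "nat \<lfloor>q\<rfloor>"]
    show "\<exists>w (g :: real ^ 'n \<Rightarrow> real ^ 1).
       int w = \<lfloor>3 * real_of_int \<lceil>(real N + 5 * C * real d) / 2\<rceil>
                 * real_binomial (real N + 5 * C * real d) d\<rfloor> \<and>
       is_shallow_tanh_net w g \<and>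
       Linf_norm unit_cube (\<lambda>x. f x - g x $ 1) \<le> ereal (exp (- real N))"
      unfolding q_def m_def x_def by (intro exI[of _ "nat \<lfloor>q\<rfloor>"]) (auto simp: q_def m_def x_def)
  next
    assume d: "d = 1"
    have xd: "x = real N + 5 * C" by (simp add: x_def d)
    \<comment> \<open>In dimension one there are \<open>D + 1\<close> nodes. For
      \<open>x \<ge> 2\<close> the width is at least \<open>3 * x / 2\<close>, hence at least
      \<open>x + 1\<close>; below 2 it is at least 3 and there are at most two nodes.\<close>
    have "real D + 1 \<le> 3 * real_of_int m"
    proof (cases "x < 2")
      case True
      then have "D \<le> 1" unfolding D_def by linarith
      then show ?thesis using m(1) by linarith
    next
      case False
      then show ?thesis using m(2) D(1) by linarith
    qed
    then have "d \<le> nat (3 * m)" "(D + d) choose d \<le> nat (3 * m)" using d m(1) by auto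
    from net[OF this] show "\<exists>w (g :: real ^ 'n \<Rightarrow> real ^ 1).
       int w = 3 * \<lceil>(real N + 5 * C) / 2\<rceil> \<and>
       is_shallow_tanh_net w g \<and>
       Linf_norm unit_cube (\<lambda>x. f x - g x $ 1) \<le> ereal (exp (- real N))"
      using m(1) unfolding xd[symmetric] m_def[symmetric] by (intro exI[of _ "nat (3 * m)"]) auto
  qed
qed

end
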